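(* Let $\gamma\in\mathbb{R}$ and let $r$ be a revenue profile as in the context which is strictly decreasing on $[0,\infty)$. Let $\eta^{\mathrm{opt}}$ be the unique solution $\eta\ge0$ of $r(\eta)=R_{\mathrm T}(\eta)$. Define $$R_{\mathrm{lower}}=R_{\mathrm T}(0)=\frac{\int_{-\infty}^0 r(x)e^{-\frac12x^2-\gamma x}\,dx}{\frac{\Phi(\gamma)}{\phi(\gamma)}},\qquad \eta^{\max}=r_{\mathrm R}^{\leftarrow}(R_{\mathrm{lower}}),$$ $$R_{\mathrm{upper}}=\frac{\int_{-\infty}^0 r(x)e^{-\frac12x^2-\gamma x}\,dx+\int_0^{\eta^{\max}}e^{-\gamma x}\,dx}{\frac{\Phi(\gamma)}{\phi(\gamma)}+\int_0^{\eta^{\max}}e^{-\gamma x}\,dx},\qquad \eta^{\min}=r_{\mathrm R}^{\leftarrow}(R_{\mathrm{upper}}).$$ Then $\eta^{\max}\ge\eta^{\mathrm{opt}}$ and $\eta^{\min}<\eta^{\mathrm{opt}}$.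
   Context: $\phi,\Phi$ are the standard normal density and distribution function. The revenue profile $r:\mathbb{R}\to[0,1]$ is continuous, piecewise smooth on $(-\infty,0]$ and on $[0,\infty)$, with $r(0)=1$, nondecreasing on $(-\infty,0]$ and not identically $1$ there, and $r(x)\to0$ as $x\to\infty$. $r_{\mathrm R}$ is the restriction of $r$ to $[0,\infty)$, and $r_{\mathrm R}^{\leftarrow}:(0,1]\to[0,\infty)$ is its inverse function. For $\eta\ge0$, $$R_{\mathrm T}(\eta)=\frac{\int_{-\infty}^0 r(x)e^{-\frac12x^2-\gamma x}\,dx+\int_0^\eta r(x)e^{-\gamma x}\,dx}{\frac{\Phi(\gamma)}{\phi(\gamma)}+\int_0^\eta e^{-\gamma x}\,dx}.$$ *)

theory Defs
  imports "HOL-Probability.Probability"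
begin

abbreviation std_normal_cdf :: "real \<Rightarrow> real" (\<open>\<Phi>\<close>) where
  "\<Phi> \<equiv> cdf std_normal_distribution"

abbreviation std_normal_pdf :: "real \<Rightarrow> real" (\<open>\<phi>\<close>) where
  "\<phi> \<equiv> std_normal_density"

text \<open>
  Piecewise smoothness on an unbounded half-line is read as piecewise continuous
  differentiability on each of its compact subintervals, so the breakpoints need only be
  locally finite. The endpoint 0 may always be a breakpoint, so \<open>r\<close> may have a kink there.
\<close>

definition revenue_profile :: "(real \<Rightarrow> real) \<Rightarrow> bool" where
  "revenue_profile r \<longleftrightarrow>
     range r \<subseteq> {0..1} \<and>
     continuous_on UNIV r \<and>
     (\<forall>a\<le>0. r piecewise_C1_differentiable_on {a..0}) \<and>
     (\<forall>b\<ge>0. r piecewise_C1_differentiable_on {0..b}) \<and>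
     r 0 = 1 \<and>
     mono_on {..0} r \<and>
     \<not> (\<forall>x\<le>0. r x = 1) \<and>
     (r \<longlongrightarrow> 0) at_top"

definition revenue_T :: "real \<Rightarrow> (real \<Rightarrow> real) \<Rightarrow> real \<Rightarrow> real" where
  "revenue_T \<gamma> r \<eta> =
     ((LBINT x:{..0}. r x * exp (- (1/2) * x\<^sup>2 - \<gamma> * x)) + (LBINT x:{0..\<eta>}. r x * exp (- \<gamma> * x)))
     / (\<Phi> \<gamma> / \<phi> \<gamma> + (LBINT x:{0..\<eta>}. exp (- \<gamma> * x)))"

text \<open>The inverse of the restriction of \<open>r\<close> to the nonnegative half-line; meaningful on \<open>{0<..1}\<close>.\<close>

definition right_inverse :: "(real \<Rightarrow> real) \<Rightarrow> real \<Rightarrow> real" where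
  "right_inverse r = the_inv_into {0..} r"

definition eta_opt :: "real \<Rightarrow> (real \<Rightarrow> real) \<Rightarrow> real" where
  "eta_opt \<gamma> r = (THE \<eta>. 0 \<le> \<eta> \<and> r \<eta> = revenue_T \<gamma> r \<eta>)"

definition revenue_lower :: "real \<Rightarrow> (real \<Rightarrow> real) \<Rightarrow> real" where
  "revenue_lower \<gamma> r = revenue_T \<gamma> r 0"

lemma revenue_lower_eq:
  "revenue_lower \<gamma> r =
     (LBINT x:{..0}. r x * exp (- (1/2) * x\<^sup>2 - \<gamma> * x)) / (\<Phi> \<gamma> / \<phi> \<gamma>)"
proof -
  have "(LBINT x:{0..0}. f x) = 0" for f :: "real \<Rightarrow> real"
    unfolding set_lebesgue_integral_def
    by (rule integral_eq_zero_AE) (use AE_lborel_singleton[of 0] in \<open>eventually_elim, auto\<close>)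
  then show ?thesis
    by (simp add: revenue_lower_def revenue_T_def)
qed

definition eta_max :: "real \<Rightarrow> (real \<Rightarrow> real) \<Rightarrow> real" where
  "eta_max \<gamma> r = right_inverse r (revenue_lower \<gamma> r)"

definition revenue_upper :: "real \<Rightarrow> (real \<Rightarrow> real) \<Rightarrow> real" where
  "revenue_upper \<gamma> r =
     ((LBINT x:{..0}. r x * exp (- (1/2) * x\<^sup>2 - \<gamma> * x)) + (LBINT x:{0..eta_max \<gamma> r}. exp (- \<gamma> * x)))
     / (\<Phi> \<gamma> / \<phi> \<gamma> + (LBINT x:{0..eta_max \<gamma> r}. exp (- \<gamma> * x)))"

definition eta_min :: "real \<Rightarrow> (real \<Rightarrow> real) \<Rightarrow> real" where
  "eta_min \<gamma> r = right_inverse r (revenue_upper \<gamma> r)"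

end

theory Submission
  imports Defs
begin

text \<open>
  Write \<open>A\<close> for the integral of \<open>r x * exp (- x\<^sup>2 / 2 - \<gamma> * x)\<close> over the negative half-line and
  \<open>B = \<Phi> \<gamma> / \<phi> \<gamma>\<close>. Completing the square shows that \<open>B\<close> is the same integral with \<open>r\<close> replaced by
  \<open>1\<close>, so \<open>0 < A < B\<close>: the profile is positive near \<open>0\<close> and below \<open>1\<close> somewhere on the left
  (\<open>weighted_left_revenue_bounds\<close>). With \<open>W t\<close> and \<open>V t\<close> the integrals over \<open>{0..t}\<close> of the
  weight \<open>exp (- \<gamma> * x)\<close> and of \<open>r\<close> times this weight, the equation \<open>r t = revenue_T \<gamma> r t\<close> says
  that the gap \<open>r t * (B + W t) - (A + V t)\<close> vanishes.

  The gap is continuous and strictly decreasing (\<open>crossing_gap_strict_decreasing\<close>): formally its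
  derivative is \<open>r' t * (B + W t)\<close>, since the two contributions \<open>r t * w t\<close> cancel. It is positive
  at \<open>0\<close>. At the upper bound \<open>M = eta_max \<gamma> r\<close>, where \<open>r M = A / B\<close>, it equals
  \<open>r M * W M - V M\<close>, which is at most \<open>0\<close> because \<open>r \<ge> r M\<close> on \<open>{0..M}\<close>. So its only zero
  \<open>t = eta_opt \<gamma> r\<close> lies in \<open>{0<..M}\<close>, which is the first claim.

  For the second claim, \<open>r t = (A + V t) / (B + W t) < (A + W t) / (B + W t)\<close>, because \<open>r < 1\<close> on
  \<open>{0<..t}\<close> and \<open>t > 0\<close>. Since \<open>A < B\<close>, the quotient \<open>(A + u) / (B + u)\<close> increases with \<open>u\<close>, so
  replacing \<open>t\<close> by the larger \<open>M\<close> bounds it by \<open>revenue_upper \<gamma> r\<close>. Thus \<open>r\<close> is smaller at \<open>t\<close>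
  than at \<open>eta_min \<gamma> r\<close>, and \<open>r\<close> is decreasing.
\<close>

section \<open>Integrals of continuous functions\<close>

lemma LBINT_Icc_eq_integral:
  fixes f :: "real \<Rightarrow> real"
  assumes "continuous_on UNIV f"
  shows "(LBINT x:{a..b}. f x) = integral {a..b} f"
  by (intro set_borel_integral_eq_integral(2) borel_integrable_atLeastAtMost'
      continuous_on_subset[OF assms]) simp

lemma LBINT_Icc_split:
  fixes f :: "real \<Rightarrow> real"
  assumes "continuous_on UNIV f" and "a \<le> b" and "b \<le> c"
  shows "(LBINT x:{a..c}. f x) = (LBINT x:{a..b}. f x) + (LBINT x:{b..c}. f x)"
proof -
  have "f integrable_on {a..c}"
    by (rule integrable_continuous_interval) (rule continuous_on_subset[OF assms(1)], simp)
  then show ?thesis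
    using Henstock_Kurzweil_Integration.integral_combine[OF assms(2,3), of f]
    by (simp add: LBINT_Icc_eq_integral[OF assms(1)])
qed

lemma continuous_on_LBINT_Icc:
  fixes f :: "real \<Rightarrow> real"
  assumes "continuous_on UNIV f"
  shows "continuous_on {a..b} (\<lambda>t. LBINT x:{a..t}. f x)"
proof -
  have "f integrable_on {a..b}"
    by (rule integrable_continuous_interval) (rule continuous_on_subset[OF assms], simp)
  then show ?thesis
    by (simp add: LBINT_Icc_eq_integral[OF assms] indefinite_integral_continuous_1)
qed

lemma LBINT_mono_Icc:
  fixes f g :: "real \<Rightarrow> real"
  assumes "continuous_on UNIV f" and "continuous_on UNIV g"
    and "\<And>x. x \<in> {a..b} \<Longrightarrow> f x \<le> g x"
  shows "(LBINT x:{a..b}. f x) \<le> (LBINT x:{a..b}. g x)"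
  using assms by (intro set_integral_mono borel_integrable_atLeastAtMost')
    (auto intro: continuous_on_subset)

text \<open>
  Every strict inequality between integrals below comes from this criterion. The nondegenerate
  interval around \<open>c\<close> inside \<open>S\<close> rules out that \<open>c\<close> is an isolated point of \<open>S\<close>; on that
  interval a continuous nonnegative function with integral \<open>0\<close> would vanish identically.
\<close>

lemma LBINT_pos:
  fixes h :: "real \<Rightarrow> real"
  assumes int: "set_integrable lborel S h" and S: "S \<in> sets borel"
    and cont: "continuous_on UNIV h"
    and nonneg: "\<And>x. x \<in> S \<Longrightarrow> 0 \<le> h x"
    and sub: "{a..b} \<subseteq> S" and "a < b" and "c \<in> {a..b}" and "0 < h c"
  shows "0 < (LBINT x:S. h x)"
proof -
  have cont_ab: "continuous_on {a..b} h"
    using cont by (rule continuous_on_subset) simp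
  have "integral {a..b} h \<noteq> 0"
    using integral_eq_0_iff[OF cont_ab \<open>a < b\<close>] nonneg sub \<open>c \<in> {a..b}\<close> \<open>0 < h c\<close> by fastforce
  moreover have "0 \<le> integral {a..b} h"
    using nonneg sub by (intro integral_nonneg integrable_continuous_interval cont_ab) auto
  ultimately have "0 < (LBINT x:{a..b}. h x)"
    by (simp add: LBINT_Icc_eq_integral[OF cont])
  also have "\<dots> \<le> (LBINT x:S. h x)"
    unfolding set_lebesgue_integral_def
  proof (rule integral_mono)
    show "integrable lborel (\<lambda>x. indicator {a..b} x *\<^sub>R h x)"
      using borel_integrable_atLeastAtMost'[OF cont_ab] by (simp add: set_integrable_def)
    show "integrable lborel (\<lambda>x. indicator S x *\<^sub>R h x)"
      using int by (simp add: set_integrable_def)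
    show "indicator {a..b} x *\<^sub>R h x \<le> indicator S x *\<^sub>R h x" for x
      using nonneg[of x] sub by (auto simp: indicator_def)
  qed
  finally show ?thesis .
qed

section \<open>The Mills ratio and the revenue from the left half-line\<close>

lemma std_normal_density_shift:
  "\<phi> (\<gamma> + x) = \<phi> \<gamma> * exp (- (1/2) * x\<^sup>2 - \<gamma> * x)"
  by (simp add: normal_density_def exp_add[symmetric] field_simps power2_eq_square)

text \<open>Up to the factor \<open>\<phi> \<gamma>\<close>, the integrand is a translate of the normal density.\<close>

lemma integrable_exp_quadratic:
  "integrable lborel (\<lambda>x::real. exp (- (1/2) * x\<^sup>2 - \<gamma> * x))"
proof -
  have "integrable lborel (\<lambda>x. \<phi> (\<gamma> + 1 * x))"
    by (subst lborel_integrable_real_affine_iff) auto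
  then have "integrable lborel (\<lambda>x. \<phi> \<gamma> * exp (- (1/2) * x\<^sup>2 - \<gamma> * x))"
    by (simp only: std_normal_density_shift mult_1)
  then show ?thesis
    using normal_density_pos[of 1 0 \<gamma>] by (simp del: normal_density_def)
qed

text \<open>
  The same translation by \<open>\<gamma>\<close> carries \<open>{..0}\<close> to \<open>{..\<gamma>}\<close>. In this form \<open>\<Phi> \<gamma> / \<phi> \<gamma>\<close> can be
  compared with the revenue integral pointwise under the integral sign.
\<close>

lemma mills_ratio_eq_LBINT:
  "\<Phi> \<gamma> / \<phi> \<gamma> = (LBINT x:{..0}. exp (- (1/2) * x\<^sup>2 - \<gamma> * x))"
proof -
  have "\<Phi> \<gamma> = (LINT x|std_normal_distribution. indicator {..\<gamma>} x)"
    by (simp add: cdf_def)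
  also have "\<dots> = (LBINT x. \<phi> x * indicator {..\<gamma>} x)"
    by (subst integral_density) auto
  also have "\<dots> = (LBINT x. \<phi> (\<gamma> + 1 * x) * indicator {..\<gamma>} (\<gamma> + 1 * x))"
    by (subst lborel_integral_real_affine[where c=1 and t=\<gamma>]) auto
  also have "\<dots> = (LBINT x. \<phi> \<gamma> * (indicator {..0} x * exp (- (1/2) * x\<^sup>2 - \<gamma> * x)))"
    by (rule Bochner_Integration.integral_cong)
      (simp_all only: std_normal_density_shift mult_1, simp add: indicator_def)
  also have "\<dots> = \<phi> \<gamma> * (LBINT x:{..0}. exp (- (1/2) * x\<^sup>2 - \<gamma> * x))"
    by (simp add: set_lebesgue_integral_def)
  finally show ?thesis
    using normal_density_pos[of 1 0 \<gamma>] by simp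
qed

text \<open>
  Both bounds are strict because \<open>r\<close> is continuous: \<open>r 0 = 1\<close> keeps it positive on an interval
  ending at \<open>0\<close>, and the profile differs from \<open>1\<close> at some \<open>c \<le> 0\<close>, hence on an interval.
\<close>

lemma weighted_left_revenue_bounds:
  assumes prof: "revenue_profile r"
  shows "0 < (LBINT x:{..0}. r x * exp (- (1/2) * x\<^sup>2 - \<gamma> * x))" (is "0 < ?A")
    and "(LBINT x:{..0}. r x * exp (- (1/2) * x\<^sup>2 - \<gamma> * x)) < \<Phi> \<gamma> / \<phi> \<gamma>"
proof -
  let ?q = "\<lambda>x::real. exp (- (1/2) * x\<^sup>2 - \<gamma> * x)"
  have cont: "continuous_on UNIV r" and bnd: "0 \<le> r x" "r x \<le> 1" and r0: "r 0 = 1" for x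
    using prof by (auto simp: revenue_profile_def image_subset_iff)
  obtain c where c: "c \<le> 0" "r c \<noteq> 1"
    using prof by (auto simp: revenue_profile_def)
  have q: "set_integrable lborel {..0} ?q"
    unfolding set_integrable_def
    by (intro integrable_mult_indicator integrable_exp_quadratic) simp
  have contrq: "continuous_on UNIV (\<lambda>x. r x * ?q x)"
    by (intro continuous_intros cont)
  have rq: "set_integrable lborel {..0} (\<lambda>x. r x * ?q x)"
  proof (rule set_integrable_bound[OF q])
    show "set_borel_measurable lborel {..0} (\<lambda>x. r x * ?q x)"
      unfolding set_borel_measurable_def
      using borel_measurable_continuous_onI[OF contrq] by simp
    show "AE x in lborel. x \<in> {..0} \<longrightarrow> norm (r x * ?q x) \<le> norm (?q x)"
      using bnd by (intro AE_I2) (auto simp: abs_mult intro: mult_left_le_one_le)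
  qed
  show "0 < ?A"
    by (rule LBINT_pos[OF rq _ contrq, of "-1" 0 0]) (auto simp: bnd r0)
  have "0 < (LBINT x:{..0}. ?q x - r x * ?q x)"
  proof (rule LBINT_pos[of _ _ "c - 1" c c])
    show "set_integrable lborel {..0} (\<lambda>x. ?q x - r x * ?q x)"
      by (intro set_integral_diff q rq)
    show "continuous_on UNIV (\<lambda>x. ?q x - r x * ?q x)"
      by (intro continuous_intros cont)
    show "0 \<le> ?q x - r x * ?q x" for x
      using bnd[of x] by (simp add: mult_left_le_one_le)
    show "0 < ?q c - r c * ?q c"
      using bnd[of c] c by simp
  qed (use c in auto)
  then show "?A < \<Phi> \<gamma> / \<phi> \<gamma>"
    unfolding mills_ratio_eq_LBINT set_integral_diff(2)[OF q rq] by linarith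
qed

section \<open>The gap whose zero is the optimal threshold\<close>

text \<open>
  The equation \<open>r t = (A + \<integral>\<^sub>0\<^sup>t r w) / (B + \<integral>\<^sub>0\<^sup>t w)\<close> with the denominator cleared, which makes
  monotonicity visible: the quotient itself need not be monotone in \<open>t\<close>.
\<close>

definition crossing_gap :: "real \<Rightarrow> real \<Rightarrow> (real \<Rightarrow> real) \<Rightarrow> (real \<Rightarrow> real) \<Rightarrow> real \<Rightarrow> real" where
  "crossing_gap A B w r t =
     r t * (B + (LBINT x:{0..t}. w x)) - (A + (LBINT x:{0..t}. r x * w x))"

lemma continuous_on_crossing_gap:
  assumes "continuous_on UNIV r" and "continuous_on UNIV w"
  shows "continuous_on {0..b} (crossing_gap A B w r)"
  unfolding crossing_gap_def
  by (intro continuous_intros continuous_on_LBINT_Icc continuous_on_subset[OF assms(1)] assms) simp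

text \<open>
  From \<open>s\<close> to \<open>t\<close> the gap changes by
  \<open>(r t - r s) * (B + \<integral>\<^sub>0\<^sup>s w) + \<integral>\<^sub>s\<^sup>t (r t - r x) * w x\<close>, where the first summand is negative and
  the second is at most \<open>0\<close>.
\<close>

lemma crossing_gap_strict_decreasing:
  assumes r: "continuous_on UNIV r" "strict_antimono_on {0..} r"
    and w: "continuous_on UNIV w" "\<And>x. 0 \<le> w x" and "0 < B"
    and "0 \<le> s" and "s < t"
  shows "crossing_gap A B w r t < crossing_gap A B w r s"
proof -
  let ?W = "\<lambda>t. LBINT x:{0..t}. w x"
  have less: "r t < r s"
    using monotone_onD[OF r(2), of s t] \<open>0 \<le> s\<close> \<open>s < t\<close> by simp
  have rw: "continuous_on UNIV (\<lambda>x. r x * w x)"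
    by (intro continuous_intros r w)
  have tw: "continuous_on UNIV (\<lambda>x. r t * w x)"
    by (intro continuous_intros w)
  have W: "?W t = ?W s + (LBINT x:{s..t}. w x)"
    using \<open>0 \<le> s\<close> \<open>s < t\<close> by (intro LBINT_Icc_split w) auto
  have R: "(LBINT x:{0..t}. r x * w x) = (LBINT x:{0..s}. r x * w x) + (LBINT x:{s..t}. r x * w x)"
    using \<open>0 \<le> s\<close> \<open>s < t\<close> by (intro LBINT_Icc_split rw) auto
  have "r t * (LBINT x:{s..t}. w x) = (LBINT x:{s..t}. r t * w x)"
    by simp
  also have "\<dots> \<le> (LBINT x:{s..t}. r x * w x)"
  proof (rule LBINT_mono_Icc[OF tw rw])
    fix x assume "x \<in> {s..t}"
    then have "r t \<le> r x"
      using monotone_onD[OF r(2), of x t] \<open>0 \<le> s\<close> by (cases "x = t") auto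
    then show "r t * w x \<le> r x * w x"
      using w(2) by (rule mult_right_mono)
  qed
  finally have inc: "r t * (LBINT x:{s..t}. w x) \<le> (LBINT x:{s..t}. r x * w x)" .
  have "0 \<le> ?W s"
    using LBINT_mono_Icc[OF continuous_on_const w(1), of 0 s 0] w(2) by simp
  then have "r t * (B + ?W s) < r s * (B + ?W s)"
    using less \<open>0 < B\<close> by (intro mult_strict_right_mono) auto
  with inc show ?thesis
    by (simp add: crossing_gap_def W R algebra_simps)
qed

section \<open>The bounds on the optimal threshold\<close>

text \<open>
  Since \<open>r\<close> decreases continuously from \<open>1\<close> to the limit \<open>0\<close>, it attains every value in \<open>{0<..1}\<close>
  exactly once on \<open>{0..}\<close>; outside this range \<open>right_inverse\<close> is an unspecified real.
\<close>

lemma right_inverse_works: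
  assumes prof: "revenue_profile r" and dec: "strict_antimono_on {0..} r"
    and "0 < y" and "y \<le> 1"
  shows "0 \<le> right_inverse r y" and "r (right_inverse r y) = y"
proof -
  have "\<forall>\<^sub>F x in at_top. r x < y"
    using prof \<open>0 < y\<close> by (auto simp: revenue_profile_def order_tendsto_iff)
  then obtain b where b: "0 \<le> b" "r b < y"
    using eventually_happens'[OF _ eventually_conj[OF eventually_ge_at_top[of 0]]]
    by (metis trivial_limit_at_top_linorder)
  have "\<exists>x\<ge>0. x \<le> b \<and> r x = y"
    using prof b \<open>y \<le> 1\<close>
    by (intro IVT2') (auto simp: revenue_profile_def intro: continuous_on_subset)
  then have y: "y \<in> r ` {0..}"
    by auto
  have inj: "inj_on r {0..}"
    by (rule linorder_inj_onI') (use monotone_onD[OF dec] in fastforce)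
  show "r (right_inverse r y) = y"
    unfolding right_inverse_def by (rule f_the_inv_into_f[OF inj y])
  show "0 \<le> right_inverse r y"
    unfolding right_inverse_def using the_inv_into_into[OF inj y subset_refl] by simp
qed

theorem proposition4:
  fixes \<gamma> :: real and r :: "real \<Rightarrow> real"
  assumes "revenue_profile r"
    and "strict_antimono_on {0..} r"
  shows "eta_max \<gamma> r \<ge> eta_opt \<gamma> r \<and> eta_min \<gamma> r < eta_opt \<gamma> r"
proof -
  define A where "A = (LBINT x:{..0}. r x * exp (- (1/2) * x\<^sup>2 - \<gamma> * x))"
  define B where "B = \<Phi> \<gamma> / \<phi> \<gamma>"
  define w where "w = (\<lambda>x. exp (- \<gamma> * x))"
  define W where "W = (\<lambda>t. LBINT x:{0..t}. w x)"
  define V where "V = (\<lambda>t. LBINT x:{0..t}. r x * w x)"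
  define M where "M = eta_max \<gamma> r"
  define U where "U = revenue_upper \<gamma> r"
  let ?gap = "crossing_gap A B w r"
  have cont: "continuous_on UNIV r" and bnd: "0 \<le> r x" "r x \<le> 1" and r0: "r 0 = 1" for x
    using assms(1) by (auto simp: revenue_profile_def image_subset_iff)
  have dec: "r t < r s" if "0 \<le> s" "s < t" for s t
    using monotone_onD[OF assms(2), of s t] that by simp
  have w: "continuous_on UNIV w" "\<And>x. 0 < w x"
    unfolding w_def by (auto intro!: continuous_intros)
  have rw: "continuous_on UNIV (\<lambda>x. r x * w x)"
    by (intro continuous_intros cont w)
  have AB: "0 < A" "A < B"
    unfolding A_def B_def by (fact weighted_left_revenue_bounds[OF assms(1)])+
  have W_mono: "W s \<le> W t" if "0 \<le> s" "s \<le> t" for s t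
    using LBINT_Icc_split[OF w(1) that] LBINT_mono_Icc[OF continuous_on_const w(1), of s t 0] w(2)
    by (simp add: W_def less_imp_le)
  have W_0: "W 0 = 0" and V_0: "V 0 = 0"
    by (simp_all add: W_def V_def LBINT_Icc_eq_integral w rw)
  have W_nonneg: "0 \<le> W t" if "0 \<le> t" for t
    using W_mono[of 0 t] that W_0 by simp
  have T: "revenue_T \<gamma> r t = (A + V t) / (B + W t)" for t
    by (simp add: revenue_T_def A_def B_def V_def W_def w_def)
  have gap: "?gap t = r t * (B + W t) - (A + V t)" for t
    by (simp add: crossing_gap_def V_def W_def)
  have root_iff: "r t = revenue_T \<gamma> r t \<longleftrightarrow> ?gap t = 0" if "0 \<le> t" for t
    using W_nonneg[OF that] AB by (auto simp: T gap field_simps)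
  have gap_less: "?gap t < ?gap s" if "0 \<le> s" "s < t" for s t
    using AB by (intro crossing_gap_strict_decreasing[OF cont assms(2) w(1) less_imp_le[OF w(2)] _ that]) simp

  have "revenue_lower \<gamma> r = A / B"
    by (simp add: revenue_lower_def T W_0 V_0)
  then have M: "0 \<le> M" "r M = A / B"
    using right_inverse_works[OF assms, of "A / B"] AB by (simp_all add: M_def eta_max_def)
  \<comment> \<open>As \<open>B * r M = A\<close>, the constants cancel in the gap at \<open>M\<close>.\<close>
  have "r M * W M = (LBINT x:{0..M}. r M * w x)"
    by (simp add: W_def)
  also have "\<dots> \<le> V M"
    unfolding V_def
  proof (rule LBINT_mono_Icc[OF _ rw])
    show "continuous_on UNIV (\<lambda>x. r M * w x)"
      by (intro continuous_intros w)
    show "r M * w x \<le> r x * w x" if "x \<in> {0..M}" for x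
      using dec[of x M] that w(2)[of x] by (cases "x = M") auto
  qed
  finally have gap_M: "?gap M \<le> 0"
    using AB by (simp add: gap M(2) field_simps)
  have gap_0: "0 < ?gap 0"
    using AB by (simp add: gap W_0 V_0 r0)
  obtain t where t: "0 \<le> t" "t \<le> M" "?gap t = 0"
    using IVT2'[OF gap_M less_imp_le[OF gap_0] M(1) continuous_on_crossing_gap[OF cont w(1)]]
    by blast
  have opt: "eta_opt \<gamma> r = t"
    unfolding eta_opt_def
  proof (rule the_equality)
    show "0 \<le> t \<and> r t = revenue_T \<gamma> r t"
      using t root_iff by simp
    show "s = t" if "0 \<le> s \<and> r s = revenue_T \<gamma> r s" for s
      using that t root_iff[of s] gap_less[of s t] gap_less[of t s] by (cases s t rule: linorder_cases) auto
  qed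
  have "0 < t"
    using t gap_0 by (cases "t = 0") auto

  have "0 < (LBINT x:{0..t}. w x - r x * w x)"
  proof (rule LBINT_pos[of _ _ 0 t t])
    show "continuous_on UNIV (\<lambda>x. w x - r x * w x)"
      by (intro continuous_intros w cont)
    then show "set_integrable lborel {0..t} (\<lambda>x. w x - r x * w x)"
      by (intro borel_integrable_atLeastAtMost') (rule continuous_on_subset, auto)
    show "0 \<le> w x - r x * w x" for x
      using bnd[of x] w(2)[of x] by (simp add: mult_left_le_one_le)
    show "0 < w t - r t * w t"
      using dec[of 0 t] r0 \<open>0 < t\<close> w(2)[of t] by simp
  qed (use \<open>0 < t\<close> in auto)
  moreover have "set_integrable lborel {0..t} w" "set_integrable lborel {0..t} (\<lambda>x. r x * w x)"
    by (auto intro!: borel_integrable_atLeastAtMost' intro: continuous_on_subset[OF w(1)] continuous_on_subset[OF rw])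
  ultimately have VW: "V t < W t"
    by (simp add: V_def W_def set_integral_diff(2))
  have U: "U = (A + W M) / (B + W M)"
    by (simp add: U_def revenue_upper_def A_def B_def W_def w_def M_def)
  have "r t = (A + V t) / (B + W t)"
    using root_iff[of t] t T by simp
  also have "\<dots> < (A + W t) / (B + W t)"
    using VW W_nonneg[of t] t AB by (intro divide_strict_right_mono) auto
  \<comment> \<open>In this form the monotonicity in \<open>W t\<close> is evident from \<open>A < B\<close>.\<close>
  also have "\<dots> = 1 - (B - A) / (B + W t)"
    using W_nonneg[of t] t AB by (simp add: field_simps)
  also have "\<dots> \<le> 1 - (B - A) / (B + W M)"
    using W_nonneg[of t] W_mono[of t M] t AB by (intro diff_left_mono divide_left_mono) auto
  also have "\<dots> = U"
    using W_nonneg[of M] M AB by (simp add: U field_simps)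
  finally have less: "r t < U" .
  have "0 < U" "U \<le> 1"
    using W_nonneg[of M] M AB by (simp_all add: U)
  then have m: "0 \<le> eta_min \<gamma> r" "r (eta_min \<gamma> r) = U"
    using right_inverse_works[OF assms, of U] by (simp_all add: eta_min_def U_def)
  have "eta_min \<gamma> r < t"
  proof (rule ccontr)
    assume "\<not> eta_min \<gamma> r < t"
    then have "r (eta_min \<gamma> r) \<le> r t"
      using dec[of t "eta_min \<gamma> r"] t by (cases "eta_min \<gamma> r = t") auto
    with m less show False
      by simp
  qed
  with t show ?thesis
    by (simp add: opt M_def)
qed

end
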